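(* Let $\rho\in\mathbb{N}$ (so $\rho\ge1$), $p>0$, $R>0$, let $w_0\in E_{\rho,p}$ be such that $w_0'$ has $m\ge0$ zeros (counting multiplicities) in $D_R$ and no zeros on $\partial D_R$, and let $U\subset E_{\rho,p}$ be the neighborhood of $w_0$ used to define the Critical Values $R$-Truncated Discriminant $\mathrm{CVD}_{U,R}$. Then for $w\in U$: (i) $\mathrm{CVD}_{U,R}(w)\ne0$ if and only if all the critical values of the function $w(z)$ in $D_R$ are pairwise different, i.e. $w(z_1),\dots,w(z_m)$ are pairwise different, where $z_1,\dots,z_m$ are the critical points of $w$ in $D_R$ counted with multiplicity as zeros of $w'$; (ii) if $\mathrm{CVD}_{U,R}(w)\ne0$, then all the critical points of $w(z)$ in $D_R$ are non-degenerate.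
   Context: $D_R=\{z\in\mathbb{C}:|z|<R\}$. $E_{\rho,p}$ is the complex vector space of entire functions $f$ with $\lim_{R\to\infty}\sup_{|z|\ge R}\frac{\ln|f(z)|}{|z|^\rho}\le p$, with the Fréchet topology generated by the norms $\|f\|_n=\sup_{z\in\mathbb{C}}\exp[-(p+1/n)|z|^\rho]|f(z)|$, $n\in\mathbb{N}$. A critical point $z_0$ of $w$ (a zero of $w'$) is non-degenerate if $w''(z_0)\neq0$. A function on an open subset of a complex Fréchet space is holomorphic if it is continuous and holomorphic along complex affine lines. Definition of $\mathrm{CVD}_{U,R}$: $U$ is an open neighborhood of $w_0$ in $E_{\rho,p}$ such that for each $w\in U$ the derivative $w'$ has exactly $m$ zeros in $D_R$ (counting multiplicities) and none on $\partial D_R$, and $w'(z)=P_m(w,z)\Phi(w,z)$ in $U\times D_R$, where $P_m(w,z)=z^m+a_{m-1}(w)z^{m-1}+\dots+a_0(w)$ is the monic polynomial in $z$ whose zeros are the zeros of $w'$ in $D_R$ with multiplicities ($P_m\equiv1$ if $m=0$), the $a_k$ are holomorphic in $U$, and $\Phi$ is holomorphic in $U\times D_R$ and nonvanishing (such $U$ exists). For $m\ge1$ let $C(w)$ be the $m\times m$ companion matrix of $P_m(w,\cdot)$ ($1$'s on the subdiagonal, last column $(-a_0(w),\dots,-a_{m-1}(w))^T$, other entries zero), let $$W(C)(w)=-\frac1{2\pi i}\oint_{\partial D_R}w(\zeta)\,(C(w)-\zeta I)^{-1}\,d\zeta ,$$ and let $\mathrm{CVD}_{U,R}(w)$ be the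 discriminant of the polynomial $\lambda\mapsto\det(W(C)(w)-\lambda I)$. For $m=0$ put $\mathrm{CVD}_{U,R}(w)=1$. *)

theory Defs
  imports
    "HOL-Complex_Analysis.Complex_Analysis"
    "Jordan_Normal_Form.Gauss_Jordan_Elimination"
    "Subresultants.Resultant_Prelim"
begin

text \<open>\<open>ln |f z| / |z|^\<rho>\<close> with the convention \<open>ln 0 = -\<infinity>\<close>.\<close>

definition log_growth :: "nat \<Rightarrow> (complex \<Rightarrow> complex) \<Rightarrow> complex \<Rightarrow> ereal" where
  "log_growth \<rho> f z =
     (if f z = 0 then -\<infinity> else ereal (ln (cmod (f z)) / cmod z ^ \<rho>))"

text \<open>The supremum below is decreasing in \<open>R\<close>, so its limit always exists in the extended reals.\<close>

definition E_space :: "nat \<Rightarrow> real \<Rightarrow> (complex \<Rightarrow> complex) set" where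
  "E_space \<rho> p = {f. f holomorphic_on UNIV \<and>
     Lim at_top (\<lambda>R::real. SUP z\<in>{z. cmod z \<ge> R}. log_growth \<rho> f z) \<le> ereal p}"

definition E_norm :: "nat \<Rightarrow> real \<Rightarrow> nat \<Rightarrow> (complex \<Rightarrow> complex) \<Rightarrow> real" where
  "E_norm \<rho> p n f = (SUP z. exp (- (p + 1 / real n) * cmod z ^ \<rho>) * cmod (f z))"

definition E_topology :: "nat \<Rightarrow> real \<Rightarrow> (complex \<Rightarrow> complex) topology" where
  "E_topology \<rho> p = topology_generated_by
     {{g \<in> E_space \<rho> p. E_norm \<rho> p n (\<lambda>z. g z - f z) < e} | f n e.
        f \<in> E_space \<rho> p \<and> n \<ge> 1 \<and> e > 0}"

lemma topspace_E_topology [simp]: "topspace (E_topology \<rho> p) = E_space \<rho> p"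
proof -
  let ?B = "\<lambda>f n e. {g \<in> E_space \<rho> p. E_norm \<rho> p n (\<lambda>z. g z - f z) < e}"
  have "\<Union>{?B f n e | f n e. f \<in> E_space \<rho> p \<and> n \<ge> 1 \<and> e > 0} = E_space \<rho> p"
  proof (rule subset_antisym)
    show "E_space \<rho> p \<subseteq> \<Union>{?B f n e | f n e. f \<in> E_space \<rho> p \<and> n \<ge> 1 \<and> e > 0}"
    proof
      fix f assume f: "f \<in> E_space \<rho> p"
      have "f \<in> ?B f 1 1"
        using f by (simp add: E_norm_def)
      moreover have "?B f 1 1 \<in> {?B f n e | f n e. f \<in> E_space \<rho> p \<and> n \<ge> 1 \<and> e > 0}"
        using f by (intro CollectI exI[of _ f] exI[of _ "1::nat"] exI[of _ "1::real"]) simp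
      ultimately show "f \<in> \<Union>{?B f n e | f n e. f \<in> E_space \<rho> p \<and> n \<ge> 1 \<and> e > 0}"
        by (rule UnionI[rotated])
    qed
  qed blast
  then show ?thesis
    unfolding E_topology_def topology_generated_by_topspace .
qed

text \<open>The carrier of the space is \<open>topspace X\<close>; \<open>line x d t\<close> is the point \<open>x + t d\<close>.\<close>

definition frechet_holomorphic_on ::
    "'v topology \<Rightarrow> ('v \<Rightarrow> 'v \<Rightarrow> complex \<Rightarrow> 'v) \<Rightarrow> 'v set \<Rightarrow> ('v \<Rightarrow> complex) \<Rightarrow> bool" where
  "frechet_holomorphic_on X line V a \<longleftrightarrow>
     continuous_map (subtopology X V) euclidean a \<and>
     (\<forall>x\<in>topspace X. \<forall>d\<in>topspace X.
        (\<lambda>t. a (line x d t)) holomorphic_on {t. line x d t \<in> V})"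

definition E_line ::
    "(complex \<Rightarrow> complex) \<Rightarrow> (complex \<Rightarrow> complex) \<Rightarrow> complex \<Rightarrow> (complex \<Rightarrow> complex)" where
  "E_line f h t = (\<lambda>z. f z + t * h z)"

definition EC_line ::
    "(complex \<Rightarrow> complex) \<times> complex \<Rightarrow> (complex \<Rightarrow> complex) \<times> complex \<Rightarrow> complex
       \<Rightarrow> (complex \<Rightarrow> complex) \<times> complex" where
  "EC_line x d t = (E_line (fst x) (fst d) t, snd x + t * snd d)"

text \<open>Zeros with multiplicities. This is only meaningful if \<open>f\<close> has finitely many zeros in \<open>S\<close>;
  otherwise the sum is the empty multiset, which is why \<^term>\<open>crit_count\<close> demands finiteness.\<close>

definition zeros_mset :: "(complex \<Rightarrow> complex) \<Rightarrow> complex set \<Rightarrow> complex multiset" where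
  "zeros_mset f S = (\<Sum>z\<in>{z\<in>S. f z = 0}. replicate_mset (nat (zorder f z)) z)"

definition crit_mset :: "real \<Rightarrow> (complex \<Rightarrow> complex) \<Rightarrow> complex multiset" where
  "crit_mset R w = zeros_mset (deriv w) (ball 0 R)"

definition crit_count :: "nat \<Rightarrow> real \<Rightarrow> (complex \<Rightarrow> complex) \<Rightarrow> bool" where
  "crit_count m R w \<longleftrightarrow>
     finite {z \<in> ball 0 R. deriv w z = 0} \<and> size (crit_mset R w) = m \<and>
     (\<forall>z\<in>sphere 0 R. deriv w z \<noteq> 0)"

definition crit_poly :: "real \<Rightarrow> (complex \<Rightarrow> complex) \<Rightarrow> complex poly" where
  "crit_poly R w = (\<Prod>z\<in>#crit_mset R w. [:- z, 1:])"

definition nondegenerate_critical_point :: "(complex \<Rightarrow> complex) \<Rightarrow> complex \<Rightarrow> bool" where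
  "nondegenerate_critical_point w z \<longleftrightarrow> deriv w z = 0 \<and> deriv (deriv w) z \<noteq> 0"

definition CVD_neighborhood ::
    "nat \<Rightarrow> real \<Rightarrow> real \<Rightarrow> nat \<Rightarrow> (complex \<Rightarrow> complex) \<Rightarrow> (complex \<Rightarrow> complex) set \<Rightarrow> bool" where
  "CVD_neighborhood \<rho> p R m w0 U \<longleftrightarrow>
     openin (E_topology \<rho> p) U \<and> w0 \<in> U \<and>
     (\<forall>w\<in>U. crit_count m R w) \<and>
     (\<forall>k<m. frechet_holomorphic_on (E_topology \<rho> p) E_line U (\<lambda>w. coeff (crit_poly R w) k)) \<and>
     (\<exists>\<Phi>. frechet_holomorphic_on (prod_topology (E_topology \<rho> p) euclidean) EC_line
             (U \<times> ball 0 R) \<Phi> \<and>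
          (\<forall>w\<in>U. \<forall>z\<in>ball 0 R. \<Phi> (w, z) \<noteq> 0 \<and> deriv w z = poly (crit_poly R w) z * \<Phi> (w, z)))"

definition poly_discriminant :: "complex poly \<Rightarrow> complex" where
  "poly_discriminant q =
     (-1) ^ (degree q * (degree q - 1) div 2) * resultant q (pderiv q) / lead_coeff q"

text \<open>Names are qualified because HOL-Analysis has its own \<open>mat\<close> and \<open>det\<close>. Indices start at 0.\<close>

definition companion :: "nat \<Rightarrow> complex poly \<Rightarrow> complex mat" where
  "companion m q = Matrix.mat m m (\<lambda>(i, j).
     if j = m - 1 then - coeff q i else if i = j + 1 then 1 else 0)"

definition resolvent :: "complex mat \<Rightarrow> complex \<Rightarrow> complex mat" where
  "resolvent C \<zeta> = the (mat_inverse (C - \<zeta> \<cdot>\<^sub>m 1\<^sub>m (dim_row C)))"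

text \<open>The matrix \<open>w(C)\<close> given by the Cauchy integral, taken entrywise.\<close>

definition cauchy_matrix :: "real \<Rightarrow> (complex \<Rightarrow> complex) \<Rightarrow> complex mat \<Rightarrow> complex mat" where
  "cauchy_matrix R w C = Matrix.mat (dim_row C) (dim_row C) (\<lambda>(i, j).
     - 1 / (2 * of_real pi * \<i>) *
       contour_integral (circlepath 0 R) (\<lambda>\<zeta>. w \<zeta> * (resolvent C \<zeta>) $$ (i, j)))"

definition det_minus_lambda :: "complex mat \<Rightarrow> complex poly" where
  "det_minus_lambda A =
     Determinant.det (map_mat (\<lambda>a. [:a:]) A - [:0, 1:] \<cdot>\<^sub>m 1\<^sub>m (dim_row A))"

text \<open>The neighborhood \<open>U\<close> enters only as the domain of \<open>w\<close> and by fixing \<open>m\<close>.\<close>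

definition CVD :: "nat \<Rightarrow> real \<Rightarrow> (complex \<Rightarrow> complex) \<Rightarrow> complex" where
  "CVD m R w = (if m = 0 then 1 else
     poly_discriminant (det_minus_lambda (cauchy_matrix R w (companion m (crit_poly R w)))))"

end

theory Submission
  imports Defs
    "HOL-Computational_Algebra.Field_as_Ring"
    "Jordan_Normal_Form.Schur_Decomposition"
    "Subresultants.Subresultant_Gcd"
begin

text \<open>The characteristic polynomial of the companion matrix \<open>C\<close> is \<open>\<Prod>(X - z\<^sub>i)\<close>, where the
  \<open>z\<^sub>i\<close> are the critical points with multiplicity, so \<open>C = P B P\<^sup>-\<^sup>1\<close> with \<open>B\<close> upper triangular and
  diagonal \<open>z\<^sub>1, \<dots>, z\<^sub>m\<close>. The Cauchy integral commutes with this conjugation, and the resolvent of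
  \<open>B\<close> is upper triangular with diagonal entries \<open>1/(z\<^sub>i - \<zeta>)\<close>; by the scalar Cauchy formula \<open>w(C)\<close>
  is therefore similar to an upper triangular matrix with diagonal \<open>w z\<^sub>1, \<dots>, w z\<^sub>m\<close>. Hence the
  discriminant vanishes iff two of the values \<open>w z\<^sub>i\<close> coincide. A degenerate critical point occurs
  at least twice among the \<open>z\<^sub>i\<close> and so forces such a coincidence.\<close>

section \<open>Determinants, inverses and discriminants\<close>

lemma continuous_on_det:
  fixes A :: "'a::topological_space \<Rightarrow> complex mat"
  assumes "\<And>x. x \<in> S \<Longrightarrow> A x \<in> carrier_mat n n"
    and "\<And>i j. i < n \<Longrightarrow> j < n \<Longrightarrow> continuous_on S (\<lambda>x. A x $$ (i, j))"
  shows "continuous_on S (\<lambda>x. Determinant.det (A x))"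
proof -
  have "continuous_on S (\<lambda>x. \<Sum>p \<in> {p. p permutes {0..<n}}. signof p * (\<Prod>i = 0..<n. A x $$ (i, p i)))"
    by (intro continuous_intros assms(2)) (auto dest: permutes_in_image)
  then show ?thesis
    using assms(1) by (subst continuous_on_cong[OF refl det_def']) auto
qed

text \<open>Gives access to the \<open>the\<close> in \<open>resolvent\<close>: a right inverse
  exhibited by hand is what Gauss-Jordan elimination returns, since for square matrices it is
  two-sided and inverses are unique.\<close>

lemma mat_inverse_eqI:
  assumes A: "A \<in> carrier_mat n n" and B: "B \<in> carrier_mat n n" and AB: "A * B = 1\<^sub>m n"
  shows "mat_inverse A = Some (B :: 'a::field mat)"
proof -
  have BA: "B * A = 1\<^sub>m n"
    using mat_mult_left_right_inverse[OF A B AB] .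
  \<comment> \<open>Membership in the unit group of the matrix ring is what rules out the result
    \<open>None\<close>.\<close>
  have "A \<in> Units (ring_mat TYPE('a) n ())"
    using A B AB BA unfolding Units_def ring_mat_def by auto
  then obtain X where X: "mat_inverse A = Some X"
    using mat_inverse(1)[OF A, where b = "()"] by (cases "mat_inverse A") auto
  have "X * A = 1\<^sub>m n" "X \<in> carrier_mat n n"
    using mat_inverse(2)[OF A X] by auto
  then have "X = B"
    using assoc_mult_mat[of X n n A n B n] A B AB by simp
  with X show ?thesis by simp
qed

text \<open>The multiset of roots of the product is \<open>mset xs\<close>, so the order of a root
  is its number of occurrences in the list.\<close>

lemma rsquarefree_prod_linear_iff_distinct:
  "rsquarefree (\<Prod>x\<leftarrow>xs. [:- x, 1:] :: 'a::field_char_0 poly) \<longleftrightarrow> distinct xs"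
proof -
  let ?p = "\<Prod>x\<leftarrow>xs. [:- x, 1:] :: 'a poly"
  have nz: "?p \<noteq> 0" by (auto simp: prod_list_zero_iff)
  have *: "proots ?p = mset xs"
  proof (induction xs)
    case (Cons x xs)
    have "(\<Prod>x\<leftarrow>xs. [:- x, 1:] :: 'a poly) \<noteq> 0"
      by (auto simp: prod_list_zero_iff)
    then have "proots ([:- x, 1:] * (\<Prod>x\<leftarrow>xs. [:- x, 1:])) = {#x#} + mset xs"
      unfolding Cons.IH[symmetric] by (subst proots_mult) (simp_all only: proots_linear_factor, simp_all)
    then show ?case by simp
  qed simp
  have "Polynomial.order a ?p = count (mset xs) a" for a
    using nz by (simp flip: *)
  then have "rsquarefree ?p \<longleftrightarrow> (\<forall>a. count (mset xs) a \<le> 1)"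
    using nz by (auto simp: rsquarefree_def le_Suc_eq simp del: count_mset)
  also have "\<dots> \<longleftrightarrow> distinct xs"
    by (auto simp: distinct_count_atmost_1 le_Suc_eq count_eq_zero_iff)
  finally show ?thesis .
qed

text \<open>The sign and the leading coefficient are nonzero, so only the resultant matters. It
  vanishes iff \<open>q\<close> and its derivative have a nonconstant gcd; over the complex numbers
  such a gcd has a root, which is a multiple root of \<open>q\<close>.\<close>

lemma poly_discriminant_nonzero_iff:
  assumes "q \<noteq> 0"
  shows "poly_discriminant q \<noteq> 0 \<longleftrightarrow> rsquarefree q"
proof -
  let ?g = "gcd q (pderiv q)"
  have "poly_discriminant q \<noteq> 0 \<longleftrightarrow> degree ?g = 0"
    using assms by (simp add: poly_discriminant_def resultant_0_gcd)
  also have "\<dots> \<longleftrightarrow> (\<forall>a. poly ?g a \<noteq> 0)"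
  proof
    assume "degree ?g = 0"
    then show "\<forall>a. poly ?g a \<noteq> 0"
      using assms by (metis gcd_eq_0_iff poly_const_conv degree_eq_zeroE pCons_eq_0_iff)
  next
    assume "\<forall>a. poly ?g a \<noteq> 0"
    then show "degree ?g = 0"
      by (metis constant_degree fundamental_theorem_of_algebra)
  qed
  also have "\<dots> \<longleftrightarrow> rsquarefree q"
    unfolding rsquarefree_roots poly_eq_0_iff_dvd by simp
  finally show ?thesis .
qed

text \<open>Back substitution: row \<open>i\<close> of \<open>U * X = 1\<close> determines row
  \<open>i\<close> of \<open>X\<close> from the rows below it, because the pivot
  \<open>U $$ (i, i)\<close> is nonzero.\<close>

lemma inverse_upper_triangular:
  fixes U X :: "'a::field mat"
  assumes U: "U \<in> carrier_mat n n" and X: "X \<in> carrier_mat n n" and UX: "U * X = 1\<^sub>m n"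
    and ut: "upper_triangular U" and nz: "\<And>i. i < n \<Longrightarrow> U $$ (i, i) \<noteq> 0"
  shows "upper_triangular X" and "i < n \<Longrightarrow> X $$ (i, i) = inverse (U $$ (i, i))"
proof -
  have row: "U $$ (i, i) * X $$ (i, j) + (\<Sum>k\<in>{i<..<n}. U $$ (i, k) * X $$ (k, j)) = (if i = j then 1 else 0)"
    if "i < n" "j < n" for i j
  proof -
    have "(if i = j then 1 else 0) = (U * X) $$ (i, j)"
      using that UX by simp
    also have "\<dots> = (\<Sum>k\<in>{0..<n}. U $$ (i, k) * X $$ (k, j))"
      using that U X by (auto simp: scalar_prod_def)
    also have "\<dots> = (\<Sum>k\<in>{i..<n}. U $$ (i, k) * X $$ (k, j))"
      using that U ut by (intro sum.mono_neutral_right) (auto simp: upper_triangular_def)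
    also have "{i..<n} = insert i {i<..<n}"
      using that by auto
    finally show ?thesis by simp
  qed
  have low: "X $$ (i, j) = 0" if "i < n" "j < i" for i j
    using that
  \<comment> \<open>The induction runs from the bottom row upwards. The remaining sum involves only
    rows k > i, whose entries in column \<open>j\<close> are again below the diagonal.\<close>
  proof (induction "n - i" arbitrary: i rule: less_induct)
    case less
    have "(\<Sum>k\<in>{i<..<n}. U $$ (i, k) * X $$ (k, j)) = 0"
      using less by (intro sum.neutral) auto
    with row[of i j] less.prems nz show ?case by auto
  qed
  then show "upper_triangular X"
    using X by (auto simp: upper_triangular_def)
  show "X $$ (i, i) = inverse (U $$ (i, i))" if "i < n"
    using row[OF that that] nz[OF that] low that by (auto simp: field_simps)
qed

section \<open>Characteristic polynomials and companion matrices\<close>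

lemma char_poly_companion_coeffs:
  "char_poly (companion n q) = monom 1 n + (\<Sum>k<n. monom (coeff q k) k)"
\<comment> \<open>Only the coefficients of \<open>q\<close> below \<open>n\<close> are read and its
  degree is left free, so the induction can pass to a shifted polynomial.\<close>
proof (induction n arbitrary: q)
  case 0
  have "char_poly_matrix (companion 0 q) \<in> carrier_mat 0 0"
    by (simp add: companion_def)
  then show ?case
    by (simp add: char_poly_def monom_0)
next
  case (Suc n)
  show ?case
  \<comment> \<open>In the 1 by 1 case the first and the last column coincide, so the expansion
    below into two separate entries has to exclude it.\<close>
  proof (cases "n = 0")
    case True
    have C: "companion (Suc n) q \<in> carrier_mat 1 1" and "upper_triangular (companion (Suc n) q)"
      using True by (auto simp: companion_def upper_triangular_def)
    moreover have "diag_mat (companion (Suc n) q) = [- coeff q 0]"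
      using True by (simp add: companion_def diag_mat_def)
    ultimately show ?thesis
      using True by (simp add: char_poly_upper_triangular monom_Suc monom_0)
  next
    case False
    let ?A = "char_poly_matrix (companion (Suc n) q)"
    have A: "?A \<in> carrier_mat (Suc n) (Suc n)"
      by (simp add: companion_def)
    have A_entry: "?A $$ (i, j) = (if i = j then [:0, 1:] else 0) +
        (if j = n then [:coeff q i:] else if i = Suc j then -1 else 0)"
      if "i < Suc n" "j < Suc n" for i j
      using that by (auto simp: char_poly_matrix_def companion_def)
    \<comment> \<open>Deleting the first row and column leaves the matrix of the polynomial (q -
      q(0))/X; the expansion along the first row thus becomes Horner's scheme.\<close>
    have minor0: "mat_delete ?A 0 0 = char_poly_matrix (companion n (poly_shift 1 q))"
    proof (rule eq_matI, goal_cases)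
      case (1 i j)
      then show ?case
        using False
        by (auto simp: mat_delete_def char_poly_matrix_def companion_def coeff_poly_shift)
    qed (auto simp: mat_delete_def char_poly_matrix_def companion_def)
    \<comment> \<open>Without the first row and the last column, the subdiagonal of -1's becomes the
      diagonal. The resulting sign cancels against that of the cofactor.\<close>
    have minorn: "Determinant.det (mat_delete ?A 0 n) = (-1) ^ n"
    proof -
      let ?M = "mat_delete ?A 0 n"
      have M: "?M \<in> carrier_mat n n"
        using mat_delete_carrier[OF A] by simp
      have entry: "?M $$ (i, j) = ?A $$ (Suc i, j)" if "i < n" "j < n" for i j
        using that A by (auto simp: mat_delete_def)
      have "upper_triangular ?M"
        using M by (auto simp: upper_triangular_def entry A_entry)
      then have "Determinant.det ?M = prod_list (diag_mat ?M)"
        using M by (rule det_upper_triangular)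
      also have "\<dots> = (\<Prod>i = 0..<n. -1)"
        using M unfolding prod_list_diag_prod by (auto simp: entry A_entry intro!: prod.cong)
      finally show ?thesis by simp
    qed
    have X_monom: "pCons 0 1 * monom c k = monom c (Suc k)" for c :: complex and k
      by (simp add: monom_Suc)
    have "char_poly (companion (Suc n) q) = (\<Sum>j<Suc n. ?A $$ (0, j) * cofactor ?A 0 j)"
      unfolding char_poly_def by (rule laplace_expansion_row[OF A]) simp
    also have "\<dots> = (\<Sum>j\<in>{0, n}. ?A $$ (0, j) * cofactor ?A 0 j)"
      by (intro sum.mono_neutral_right) (auto simp: A_entry)
    also have "\<dots> = [:0, 1:] * char_poly (companion n (poly_shift 1 q)) + [:coeff q 0:]"
      using False
      by (simp add: A_entry cofactor_def minor0 minorn char_poly_def flip: power_add mult_2 power_mult_distrib)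
    also have "\<dots> = monom 1 (Suc n) + (\<Sum>k<Suc n. monom (coeff q k) k)"
      unfolding Suc.IH sum.lessThan_Suc_shift
      by (simp add: coeff_poly_shift X_monom monom_0 distrib_left sum_distrib_left
          del: mult_pCons_left)
    finally show ?thesis .
  qed
qed

lemma char_poly_companion:
  assumes "monic q"
  shows "char_poly (companion (degree q) q) = q"
proof -
  have "char_poly (companion (degree q) q) = (\<Sum>k\<le>degree q. monom (coeff q k) k)"
    using assms by (simp add: char_poly_companion_coeffs flip: lessThan_Suc_atMost)
  then show ?thesis
    by (simp add: poly_as_sum_of_monoms)
qed

lemma monic_prod_linear: "monic (\<Prod>x\<leftarrow>xs. [:- x, 1:] :: 'a::idom poly)"
  by (induction xs) (simp_all add: lead_coeff_mult del: mult_pCons_left)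

lemma det_minus_lambda_eq_char_poly:
  assumes "A \<in> carrier_mat n n"
  shows "det_minus_lambda A = (-1) ^ n * char_poly A"
proof -
  have "map_mat (\<lambda>a. [:a:]) A - [:0, 1:] \<cdot>\<^sub>m 1\<^sub>m (dim_row A) = (-1) \<cdot>\<^sub>m char_poly_matrix A"
    using assms by (intro eq_matI) (auto simp: char_poly_matrix_def)
  moreover have "dim_col (char_poly_matrix A) = n"
    using char_poly_matrix_closed[OF assms] by blast
  ultimately show ?thesis
    by (simp add: det_minus_lambda_def char_poly_def)
qed

section \<open>The resolvent\<close>

lemma resolvent_eqI:
  assumes "C \<in> carrier_mat n n" "X \<in> carrier_mat n n" "(C - \<zeta> \<cdot>\<^sub>m 1\<^sub>m n) * X = 1\<^sub>m n"
  shows "resolvent C \<zeta> = X"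
proof -
  have "mat_inverse (C - \<zeta> \<cdot>\<^sub>m 1\<^sub>m n) = Some X"
    using assms by (intro mat_inverse_eqI[of _ n]) auto
  with assms(1) show ?thesis by (simp add: resolvent_def)
qed

text \<open>Cramer's rule. The explicit formula exposes the dependence on \<zeta>, which
  Gauss-Jordan elimination hides.\<close>

lemma resolvent_adj_mat:
  fixes C :: "complex mat"
  assumes C: "C \<in> carrier_mat n n" and nz: "Determinant.det (C - \<zeta> \<cdot>\<^sub>m 1\<^sub>m n) \<noteq> 0"
  defines "D \<equiv> C - \<zeta> \<cdot>\<^sub>m 1\<^sub>m n"
  shows "resolvent C \<zeta> = inverse (Determinant.det D) \<cdot>\<^sub>m adj_mat D"
    and "resolvent C \<zeta> \<in> carrier_mat n n"
    and "D * resolvent C \<zeta> = 1\<^sub>m n"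
proof -
  let ?X = "inverse (Determinant.det D) \<cdot>\<^sub>m adj_mat D"
  have D: "D \<in> carrier_mat n n"
    by (simp add: D_def minus_carrier_mat)
  have X: "?X \<in> carrier_mat n n"
    using adj_mat(1)[OF D] by simp
  have DX: "D * ?X = 1\<^sub>m n"
    unfolding mult_smult_distrib[OF D adj_mat(1)[OF D]] adj_mat(2)[OF D]
    using nz by (intro eq_matI) (auto simp: D_def)
  show "resolvent C \<zeta> = ?X"
    using C X DX unfolding D_def by (rule resolvent_eqI)
  then show "resolvent C \<zeta> \<in> carrier_mat n n" "D * resolvent C \<zeta> = 1\<^sub>m n"
    using X DX by simp_all
qed

text \<open>Needed for the integrals of the entries to exist. Each entry is a cofactor divided by a
  nonvanishing determinant, and both are continuous in \<zeta>.\<close>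

lemma continuous_on_resolvent:
  assumes C: "C \<in> carrier_mat n n"
    and nz: "\<And>\<zeta>. \<zeta> \<in> S \<Longrightarrow> Determinant.det (C - \<zeta> \<cdot>\<^sub>m 1\<^sub>m n) \<noteq> 0"
    and ij: "i < n" "j < n"
  shows "continuous_on S (\<lambda>\<zeta>. resolvent C \<zeta> $$ (i, j))"
proof -
  let ?D = "\<lambda>\<zeta>. C - \<zeta> \<cdot>\<^sub>m 1\<^sub>m n"
  have entry: "continuous_on S (\<lambda>\<zeta>. ?D \<zeta> $$ (k, l))" if "k < n" "l < n" for k l
    using that C by (auto intro!: continuous_intros)
  have "continuous_on S (\<lambda>\<zeta>. Determinant.det (mat_delete (?D \<zeta>) j i))"
  proof (rule continuous_on_det)
    show "mat_delete (?D \<zeta>) j i \<in> carrier_mat (n - 1) (n - 1)" for \<zeta>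
      by (intro mat_delete_carrier minus_carrier_mat) simp
    show "continuous_on S (\<lambda>\<zeta>. mat_delete (?D \<zeta>) j i $$ (k, l))" if "k < n - 1" "l < n - 1" for k l
    proof -
      have "mat_delete (?D \<zeta>) j i $$ (k, l) =
          ?D \<zeta> $$ (if k < j then k else Suc k, if l < i then l else Suc l)" for \<zeta>
        using that C by (simp add: mat_delete_def)
      moreover have "continuous_on S
          (\<lambda>\<zeta>. ?D \<zeta> $$ (if k < j then k else Suc k, if l < i then l else Suc l))"
        using that by (intro entry) auto
      ultimately show ?thesis by presburger
    qed
  qed
  moreover have "continuous_on S (\<lambda>\<zeta>. Determinant.det (?D \<zeta>))"
    by (intro continuous_on_det[of _ _ n] entry minus_carrier_mat) auto
  ultimately have "continuous_on S (\<lambda>\<zeta>. inverse (Determinant.det (?D \<zeta>)) * cofactor (?D \<zeta>) j i)"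
    unfolding cofactor_def by (intro continuous_intros) (use nz in auto)
  moreover have "resolvent C \<zeta> $$ (i, j) = inverse (Determinant.det (?D \<zeta>)) * cofactor (?D \<zeta>) j i"
    if "\<zeta> \<in> S" for \<zeta>
    using C ij by (simp add: resolvent_adj_mat(1)[OF C nz[OF that]] adj_mat_def)
  ultimately show ?thesis
    by (subst continuous_on_cong[OF refl]) auto
qed

text \<open>Scalar matrices are fixed by conjugation, so \<open>C\<close> and \<open>B\<close> may
  both be shifted by \<zeta>; inverting commutes with conjugation because \<open>Q * P\<close>
  cancels in the middle.\<close>

lemma resolvent_similar:
  assumes sim: "similar_mat_wit C B P Q" and C: "C \<in> carrier_mat n n"
    and nz: "Determinant.det (B - \<zeta> \<cdot>\<^sub>m 1\<^sub>m n) \<noteq> 0"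
  shows "resolvent C \<zeta> = P * resolvent B \<zeta> * Q"
proof -
  note s = similar_mat_witD2[OF C sim]
  let ?D = "B - \<zeta> \<cdot>\<^sub>m 1\<^sub>m n" and ?X = "resolvent B \<zeta>"
  have D: "?D \<in> carrier_mat n n"
    by (simp add: minus_carrier_mat)
  note X = resolvent_adj_mat(2,3)[OF s(5) nz]
  have "P * (\<zeta> \<cdot>\<^sub>m 1\<^sub>m n) * Q = \<zeta> \<cdot>\<^sub>m 1\<^sub>m n"
    unfolding mult_smult_distrib[OF s(6) one_carrier_mat] right_mult_one_mat[OF s(6)]
      mult_smult_assoc_mat[OF s(6,7)] s(1) ..
  then have CD: "C - \<zeta> \<cdot>\<^sub>m 1\<^sub>m n = P * ?D * Q"
    using s by (simp add: mult_minus_distrib_mat[of P n n B n] minus_mult_distrib_mat[of _ n n _ Q n])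
  have "P * ?D * Q * (P * ?X * Q) = P * (?D * ((Q * P) * (?X * Q)))"
    using s(5-7) D X(1) by (simp add: assoc_mult_mat[of _ n n _ n _ n])
  also have "\<dots> = P * ((?D * ?X) * Q)"
    using s(2,5-7) D X(1) by (simp add: assoc_mult_mat[of _ n n _ n _ n])
  also have "\<dots> = 1\<^sub>m n"
    using s by (simp add: X(2))
  finally have inv: "(C - \<zeta> \<cdot>\<^sub>m 1\<^sub>m n) * (P * ?X * Q) = 1\<^sub>m n"
    unfolding CD .
  have "P * ?X * Q \<in> carrier_mat n n"
    using s(6,7) X(1) by simp
  from resolvent_eqI[OF C this inv] show ?thesis .
qed

section \<open>The Cauchy integral under conjugation and for triangular matrices\<close>

lemma mult_mat_mat_index:
  fixes P X Q :: "'a::comm_semiring_1 mat"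
  assumes "P \<in> carrier_mat n n" "X \<in> carrier_mat n n" "Q \<in> carrier_mat n n" "i < n" "j < n"
  shows "(P * X * Q) $$ (i, j) = (\<Sum>k<n. \<Sum>l<n. P $$ (i, k) * Q $$ (l, j) * X $$ (k, l))"
  using assms
  by (auto simp: scalar_prod_def sum_distrib_left sum_distrib_right atLeast0LessThan mult_ac
      intro!: sum.cong)

text \<open>\<open>P\<close> and \<open>Q\<close> do not depend on \<zeta>, so each entry for
  \<open>C\<close> is a constant linear combination of entries for \<open>B\<close>, and linearity
  of the integral applies.\<close>

lemma cauchy_matrix_similar:
  assumes sim: "similar_mat_wit C B P Q" and C: "C \<in> carrier_mat n n" and "R > 0"
    and w: "continuous_on (sphere 0 R) w"
    and nz: "\<And>\<zeta>. \<zeta> \<in> sphere 0 R \<Longrightarrow> Determinant.det (B - \<zeta> \<cdot>\<^sub>m 1\<^sub>m n) \<noteq> 0"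
  shows "cauchy_matrix R w C = P * cauchy_matrix R w B * Q"
proof -
  note s = similar_mat_witD2[OF C sim]
  let ?I = "\<lambda>A i j. contour_integral (circlepath 0 R) (\<lambda>\<zeta>. w \<zeta> * resolvent A \<zeta> $$ (i, j))"
  have W: "cauchy_matrix R w B \<in> carrier_mat n n"
    using s by (simp add: cauchy_matrix_def)
  have img: "path_image (circlepath 0 R) = sphere 0 R"
    using \<open>R > 0\<close> by simp
  \<comment> \<open>Linearity needs genuine integrability: otherwise \<open>contour_integral\<close>
    is only a default value.\<close>
  have int: "((\<lambda>\<zeta>. w \<zeta> * resolvent B \<zeta> $$ (k, l)) has_contour_integral ?I B k l) (circlepath 0 R)"
    if "k < n" "l < n" for k l
  proof -
    have "continuous_on (sphere 0 R) (\<lambda>\<zeta>. resolvent B \<zeta> $$ (k, l))"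
      by (rule continuous_on_resolvent[OF s(5) nz that])
    then show ?thesis
      using w unfolding img[symmetric]
      by (intro has_contour_integral_integral contour_integrable_continuous_circlepath continuous_intros)
  qed
  have I_eq: "?I C i j = (\<Sum>k<n. \<Sum>l<n. P $$ (i, k) * Q $$ (l, j) * ?I B k l)" if "i < n" "j < n" for i j
  proof (rule contour_integral_unique, rule has_contour_integral_eq)
    show "((\<lambda>\<zeta>. \<Sum>k<n. \<Sum>l<n. P $$ (i, k) * Q $$ (l, j) * (w \<zeta> * resolvent B \<zeta> $$ (k, l)))
        has_contour_integral (\<Sum>k<n. \<Sum>l<n. P $$ (i, k) * Q $$ (l, j) * ?I B k l)) (circlepath 0 R)"
      by (intro has_contour_integral_sum has_contour_integral_lmul int) auto
    show "(\<Sum>k<n. \<Sum>l<n. P $$ (i, k) * Q $$ (l, j) * (w \<zeta> * resolvent B \<zeta> $$ (k, l))) =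
        w \<zeta> * resolvent C \<zeta> $$ (i, j)" if "\<zeta> \<in> path_image (circlepath 0 R)" for \<zeta>
    proof -
      have z: "Determinant.det (B - \<zeta> \<cdot>\<^sub>m 1\<^sub>m n) \<noteq> 0"
        using nz that unfolding img by blast
      show ?thesis
        unfolding resolvent_similar[OF sim C z]
          mult_mat_mat_index[OF s(6) resolvent_adj_mat(2)[OF s(5) z] s(7) \<open>i < n\<close> \<open>j < n\<close>]
        by (simp add: sum_distrib_left mult_ac)
    qed
  qed
  show ?thesis
  proof (rule eq_matI)
    fix i j assume "i < dim_row (P * cauchy_matrix R w B * Q)" "j < dim_col (P * cauchy_matrix R w B * Q)"
    then have ij: "i < n" "j < n"
      using s by auto
    have "cauchy_matrix R w C $$ (i, j) = - 1 / (2 * of_real pi * \<i>) * ?I C i j"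
      using C ij by (simp add: cauchy_matrix_def)
    also have "\<dots> = (\<Sum>k<n. \<Sum>l<n. P $$ (i, k) * Q $$ (l, j) * cauchy_matrix R w B $$ (k, l))"
      using s ij unfolding I_eq[OF ij] sum_distrib_left
      by (intro sum.cong) (auto simp: cauchy_matrix_def)
    finally show "cauchy_matrix R w C $$ (i, j) = (P * cauchy_matrix R w B * Q) $$ (i, j)"
      unfolding mult_mat_mat_index[OF s(6) W s(7) ij] .
  qed (use C s in \<open>auto simp: cauchy_matrix_def\<close>)
qed

lemma det_upper_triangular_minus_nonzero:
  fixes B :: "complex mat"
  assumes "B \<in> carrier_mat n n" "upper_triangular B" "\<And>i. i < n \<Longrightarrow> B $$ (i, i) \<noteq> \<zeta>"
  shows "Determinant.det (B - \<zeta> \<cdot>\<^sub>m 1\<^sub>m n) \<noteq> 0"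
proof -
  have "upper_triangular (B - \<zeta> \<cdot>\<^sub>m 1\<^sub>m n)"
    using assms by (auto simp: upper_triangular_def)
  then have "Determinant.det (B - \<zeta> \<cdot>\<^sub>m 1\<^sub>m n) = prod_list (diag_mat (B - \<zeta> \<cdot>\<^sub>m 1\<^sub>m n))"
    using assms by (intro det_upper_triangular) auto
  then show ?thesis
    using assms unfolding prod_list_diag_prod by auto
qed

text \<open>That the diagonal lies in the open disc serves twice: the resolvent exists on the whole
  circle, and Cauchy's formula applies at each diagonal entry.\<close>

lemma cauchy_matrix_upper_triangular:
  assumes B: "B \<in> carrier_mat n n" and ut: "upper_triangular B"
    and diag: "\<And>i. i < n \<Longrightarrow> B $$ (i, i) \<in> ball 0 R"
    and w: "w holomorphic_on cball 0 R" and "R > 0"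
  shows "upper_triangular (cauchy_matrix R w B)"
    and "i < n \<Longrightarrow> cauchy_matrix R w B $$ (i, i) = w (B $$ (i, i))"
proof -
  have res: "upper_triangular (resolvent B \<zeta>)"
      "i < n \<Longrightarrow> resolvent B \<zeta> $$ (i, i) = inverse (B $$ (i, i) - \<zeta>)"
      "resolvent B \<zeta> \<in> carrier_mat n n"
    if "\<zeta> \<in> sphere 0 R" for \<zeta> i
  proof -
    let ?D = "B - \<zeta> \<cdot>\<^sub>m 1\<^sub>m n"
    have neq: "B $$ (i, i) \<noteq> \<zeta>" if "i < n" for i
      using diag[OF that] \<open>\<zeta> \<in> sphere 0 R\<close> by auto
    note X = resolvent_adj_mat(2,3)[OF B det_upper_triangular_minus_nonzero[OF B ut neq]]
    have D: "?D \<in> carrier_mat n n" "upper_triangular ?D"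
      using B ut by (auto simp: upper_triangular_def)
    have D_diag: "?D $$ (i, i) = B $$ (i, i) - \<zeta>" if "i < n" for i
      using B that by simp
    have D_nz: "?D $$ (i, i) \<noteq> 0" if "i < n" for i
      using neq[OF that] D_diag[OF that] by simp
    show "upper_triangular (resolvent B \<zeta>)" "resolvent B \<zeta> \<in> carrier_mat n n"
      using inverse_upper_triangular(1)[OF D(1) X D(2) D_nz] X by blast+
    show "resolvent B \<zeta> $$ (i, i) = inverse (B $$ (i, i) - \<zeta>)" if "i < n"
      using inverse_upper_triangular(2)[OF D(1) X D(2) D_nz that] D_diag[OF that] by simp
  qed
  have img: "path_image (circlepath 0 R) = sphere 0 R"
    using \<open>R > 0\<close> by simp
  show "upper_triangular (cauchy_matrix R w B)"
    unfolding upper_triangular_def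
  proof (intro allI impI)
    fix i j assume i: "i < dim_row (cauchy_matrix R w B)" and j: "j < i"
    then have ij: "i < n" "j < n"
      using B by (auto simp: cauchy_matrix_def)
    have "contour_integral (circlepath 0 R) (\<lambda>\<zeta>. w \<zeta> * resolvent B \<zeta> $$ (i, j)) =
        contour_integral (circlepath 0 R) (\<lambda>\<zeta>. 0)"
    \<comment> \<open>The integrands need to agree only on the circle; at an eigenvalue inside the
      disc \<open>resolvent\<close> is unspecified.\<close>
    proof (rule contour_integral_eq)
      fix \<zeta> assume "\<zeta> \<in> path_image (circlepath 0 R)"
      then have "\<zeta> \<in> sphere 0 R"
        unfolding img .
      then have "resolvent B \<zeta> $$ (i, j) = 0"
        using upper_triangularD[OF res(1) j] res(3) ij by auto
      then show "w \<zeta> * resolvent B \<zeta> $$ (i, j) = 0"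
        by simp
    qed
    with B ij show "cauchy_matrix R w B $$ (i, j) = 0"
      by (simp add: cauchy_matrix_def)
  qed
  show "cauchy_matrix R w B $$ (i, i) = w (B $$ (i, i))" if i: "i < n"
  proof -
    let ?b = "B $$ (i, i)"
    have "((\<lambda>\<zeta>. w \<zeta> / (\<zeta> - ?b)) has_contour_integral (2 * of_real pi * \<i> * w ?b)) (circlepath 0 R)"
      using diag[OF i] w by (intro Cauchy_integral_circlepath_simple) auto
    \<comment> \<open>The resolvent has the kernel 1/(b - \<zeta>), the negative of the Cauchy
      kernel. The minus sign in \<open>cauchy_matrix\<close> compensates for this.\<close>
    then have "((\<lambda>\<zeta>. - (w \<zeta> / (\<zeta> - ?b))) has_contour_integral - (2 * of_real pi * \<i> * w ?b)) (circlepath 0 R)"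
      by (rule has_contour_integral_neg)
    then have "((\<lambda>\<zeta>. w \<zeta> * resolvent B \<zeta> $$ (i, i)) has_contour_integral - (2 * of_real pi * \<i> * w ?b)) (circlepath 0 R)"
    proof (rule has_contour_integral_eq)
      show "- (w \<zeta> / (\<zeta> - ?b)) = w \<zeta> * resolvent B \<zeta> $$ (i, i)" if "\<zeta> \<in> path_image (circlepath 0 R)" for \<zeta>
        using that res(2)[OF _ i] unfolding img
        using inverse_minus_eq[of "\<zeta> - ?b"] by (simp add: divide_inverse)
    qed
    from contour_integral_unique[OF this] B i show ?thesis
      by (simp add: cauchy_matrix_def)
  qed
qed

section \<open>From the Cauchy integral to the critical values\<close>

lemma det_minus_lambda_cauchy_matrix:
  assumes C: "C \<in> carrier_mat n n" and cp: "char_poly C = (\<Prod>z\<leftarrow>zs. [:- z, 1:])"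
    and zs: "set zs \<subseteq> ball 0 R" and w: "w holomorphic_on cball 0 R" and "R > 0"
  shows "det_minus_lambda (cauchy_matrix R w C) = (-1) ^ n * (\<Prod>z\<leftarrow>zs. [:- w z, 1:])"
proof -
  \<comment> \<open>The Schur decomposition puts the prescribed roots \<open>zs\<close> on the
    diagonal in the given order, repetitions included.\<close>
  obtain B P Q where "schur_decomposition C zs = (B, P, Q)"
    by (metis prod_cases3)
  from schur_decomposition[OF C cp this]
  have sim: "similar_mat_wit C B P Q" and ut: "upper_triangular B" and diag: "diag_mat B = zs"
    by auto
  note s = similar_mat_witD2[OF C sim]
  let ?W = "cauchy_matrix R w B"
  have WB: "?W \<in> carrier_mat n n" and WC: "cauchy_matrix R w C \<in> carrier_mat n n"
    using s by (auto simp: cauchy_matrix_def)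
  have in_ball: "B $$ (i, i) \<in> ball 0 R" if "i < n" for i
  proof -
    have "B $$ (i, i) \<in> set (diag_mat B)"
      using that s by (auto simp: diag_mat_def)
    with diag zs show ?thesis by blast
  qed
  have "cauchy_matrix R w C = P * ?W * Q"
  proof (rule cauchy_matrix_similar[OF sim C \<open>R > 0\<close>])
    show "continuous_on (sphere 0 R) w"
      using w by (meson holomorphic_on_imp_continuous_on continuous_on_subset sphere_cball)
    show "Determinant.det (B - \<zeta> \<cdot>\<^sub>m 1\<^sub>m n) \<noteq> 0" if "\<zeta> \<in> sphere 0 R" for \<zeta>
      using that in_ball by (intro det_upper_triangular_minus_nonzero s ut) fastforce
  qed
  then have "similar_mat_wit (cauchy_matrix R w C) ?W P Q"
    using s WB WC by (intro similar_mat_witI) auto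
  then have "char_poly (cauchy_matrix R w C) = char_poly ?W"
    by (intro char_poly_similar) (auto simp: similar_mat_def)
  also have "\<dots> = (\<Prod>a\<leftarrow>diag_mat ?W. [:- a, 1:])"
    by (rule char_poly_upper_triangular[OF WB cauchy_matrix_upper_triangular(1)[OF s(5) ut in_ball w \<open>R > 0\<close>]])
  also have "diag_mat ?W = map w (diag_mat B)"
    using WB s cauchy_matrix_upper_triangular(2)[OF s(5) ut in_ball w \<open>R > 0\<close>] by (auto simp: diag_mat_def)
  finally show ?thesis
    by (simp add: det_minus_lambda_eq_char_poly[OF WC] diag o_def)
qed

lemma CVD_nonzero_iff_distinct:
  assumes zs: "mset zs = crit_mset R w" "length zs = m" "set zs \<subseteq> ball 0 R"
    and w: "w holomorphic_on cball 0 R" and "R > 0"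
  shows "CVD m R w \<noteq> 0 \<longleftrightarrow> distinct (map w zs)"
proof (cases "m = 0")
  \<comment> \<open>Here \<open>CVD\<close> is 1 by convention and the list is empty, hence
    distinct.\<close>
  case True
  with zs show ?thesis by (simp add: CVD_def)
next
  case False
  let ?C = "companion m (crit_poly R w)"
  have cp: "crit_poly R w = (\<Prod>z\<leftarrow>zs. [:- z, 1:])"
    unfolding crit_poly_def zs(1)[symmetric] by (simp flip: prod_mset_prod_list)
  have deg: "degree (crit_poly R w) = m"
    unfolding cp degree_linear_factors by (rule zs(2))
  have C: "?C \<in> carrier_mat m m"
    by (simp add: companion_def)
  have "char_poly ?C = (\<Prod>z\<leftarrow>zs. [:- z, 1:])"
    using char_poly_companion[of "crit_poly R w"] monic_prod_linear[of zs] deg cp by simp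
  from det_minus_lambda_cauchy_matrix[OF C this zs(3) w \<open>R > 0\<close>]
  have "det_minus_lambda (cauchy_matrix R w ?C) =
      Polynomial.smult ((-1) ^ m) (\<Prod>x\<leftarrow>map w zs. [:- x, 1:])" (is "?q = _")
    by (cases "even m") (simp_all add: o_def)
  moreover have "(\<Prod>x\<leftarrow>map w zs. [:- x, 1:]) \<noteq> 0"
    using monic_prod_linear[of "map w zs"] by force
  \<comment> \<open>Disposes of the factor \<open>(-1) ^ m\<close> between det(W - lambda I) and the
    monic characteristic polynomial: scaling preserves the order of every root.\<close>
  moreover have "rsquarefree (Polynomial.smult c p) \<longleftrightarrow> rsquarefree p" if "c \<noteq> 0" for c and p :: "complex poly"
    using that by (simp add: rsquarefree_def order_smult)
  ultimately have "poly_discriminant ?q \<noteq> 0 \<longleftrightarrow> distinct (map w zs)"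
    using poly_discriminant_nonzero_iff[of ?q] rsquarefree_prod_linear_iff_distinct[of "map w zs"] by simp
  with False show ?thesis by (simp add: CVD_def)
qed

section \<open>Multiplicity and degeneracy of critical points\<close>

lemma count_zeros_mset:
  assumes "finite {z \<in> S. f z = 0}"
  shows "count (zeros_mset f S) z = (if z \<in> S \<and> f z = 0 then nat (zorder f z) else 0)"
proof -
  have "count (zeros_mset f S) z = (\<Sum>x\<in>{z \<in> S. f z = 0}. if x = z then nat (zorder f x) else 0)"
    by (auto simp: zeros_mset_def count_sum intro!: sum.cong)
  also have "\<dots> = (if z \<in> S \<and> f z = 0 then nat (zorder f z) else 0)"
    using assms by (simp add: sum.delta)
  finally show ?thesis .
qed

text \<open>If the value and the first derivative both vanish, the order is at least 2. The point
  \<open>u\<close> excludes the zero function, for which the order carries no information.\<close>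

lemma zorder_le_1_imp_deriv_nonzero:
  assumes f: "f holomorphic_on UNIV" and nz: "f u \<noteq> 0"
    and "f z = 0" and "zorder f z \<le> 1"
  shows "deriv f z \<noteq> 0"
proof
  assume "deriv f z = 0"
  then have "(deriv ^^ k) f z = 0" if "k < 2" for k
    using that \<open>f z = 0\<close> by (auto simp: less_2_cases_iff)
  moreover have "f analytic_on {z}"
    using f by (metis analytic_on_open analytic_on_subset open_UNIV subset_UNIV)
  ultimately have "zorder f z \<ge> int 2"
    using f nz by (intro zorder_geI[where A = UNIV and z = u]) auto
  with \<open>zorder f z \<le> 1\<close> show False by simp
qed

theorem proposition6p3:
  fixes \<rho> m :: nat and p R :: real
    and w0 w :: "complex \<Rightarrow> complex" and U :: "(complex \<Rightarrow> complex) set"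
  assumes "\<rho> \<ge> 1" and "p > 0" and "R > 0"
    and "w0 \<in> E_space \<rho> p" and "crit_count m R w0"
    and "CVD_neighborhood \<rho> p R m w0 U"
    and "w \<in> U"
  shows "(\<forall>zs. mset zs = crit_mset R w \<longrightarrow> (CVD m R w \<noteq> 0 \<longleftrightarrow> distinct (map w zs)))
       \<and> (CVD m R w \<noteq> 0 \<longrightarrow>
            (\<forall>z\<in>ball 0 R. deriv w z = 0 \<longrightarrow> nondegenerate_critical_point w z))"
proof -
  from assms have "openin (E_topology \<rho> p) U" and crit: "crit_count m R w"
    by (auto simp: CVD_neighborhood_def)
  \<comment> \<open>An open set lies in the topspace, which is \<open>E_space\<close>; this makes
    \<open>w\<close> entire.\<close>
  then have "w \<in> E_space \<rho> p"
    using \<open>w \<in> U\<close> openin_subset by fastforce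
  then have hol: "w holomorphic_on UNIV"
    by (simp add: E_space_def)
  have fin: "finite {z \<in> ball 0 R. deriv w z = 0}" and size: "size (crit_mset R w) = m"
    using crit by (auto simp: crit_count_def)
  note count = count_zeros_mset[OF fin, folded crit_mset_def]
  have iff: "CVD m R w \<noteq> 0 \<longleftrightarrow> distinct (map w zs)" if zs: "mset zs = crit_mset R w" for zs
  proof (rule CVD_nonzero_iff_distinct[OF zs])
    show "length zs = m"
      using zs size by (metis size_mset)
    show "set zs \<subseteq> ball 0 R"
    proof
      fix z assume "z \<in> set zs"
      then have "count (crit_mset R w) z \<noteq> 0"
        using zs by (metis count_eq_zero_iff set_mset_mset)
      then show "z \<in> ball 0 R"
        unfolding count by (auto split: if_splits)
    qed
    show "w holomorphic_on cball 0 R"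
      using hol holomorphic_on_subset by blast
  qed (fact \<open>R > 0\<close>)
  moreover have "nondegenerate_critical_point w z"
    if cvd: "CVD m R w \<noteq> 0" and z: "z \<in> ball 0 R" "deriv w z = 0" for z
  proof -
    obtain zs where zs: "mset zs = crit_mset R w"
      using ex_mset by blast
    \<comment> \<open>A critical point listed twice would repeat its own critical value, so distinct
      values force distinct points.\<close>
    with iff cvd have "distinct zs"
      by (simp add: distinct_map)
    then have "count (crit_mset R w) z \<le> 1"
      by (auto simp: zs[symmetric] distinct_count_atmost_1)
    then have ord: "zorder (deriv w) z \<le> 1"
      using count z by simp
    have "deriv w holomorphic_on UNIV"
      using hol by (intro holomorphic_deriv) auto
    \<comment> \<open>The point \<open>of_real R\<close> lies on the boundary circle, where
      \<open>crit_count\<close> forbids zeros; it witnesses that the derivative is not identically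
      zero.\<close>
    moreover have "deriv w (of_real R) \<noteq> 0"
      using crit \<open>R > 0\<close> by (auto simp: crit_count_def)
    ultimately show ?thesis
      using zorder_le_1_imp_deriv_nonzero z(2) ord
      by (auto simp: nondegenerate_critical_point_def)
  qed
  ultimately show ?thesis by blast
qed
end
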